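(* Let $A\in\mathcal M_n(\mathbb R_{++})$ be a square matrix with positive entries. If $\lambda\in\mathbb R_{++}$ is a $\boxtimes$-eigenvalue of $A$, then $P_{A,-}^{(\infty)}(\lambda)+P_{A,+}^{(\infty)}(\lambda)=0$. Moreover, if $\lambda$ is maximal in the set $\{\mu\in\mathbb R:P_{A,-}^{(\infty)}(\mu)+P_{A,+}^{(\infty)}(\mu)=0\}$, then $\lambda$ is a $\boxtimes$-eigenvalue of $A$ and $\lambda=\lim_{q\to\infty}\rho_A^{(p_q)}$ for some increasing sequence $\{p_q\}_{q\in\mathbb N}$ of natural numbers.
   Context: $[n]=\{1,\dots,n\}$; $\mathbb R_{++}$ is the set of positive reals. For a finite family of reals $(x_i)_{i\in I}$, with $\xi(\alpha)=\mathrm{Card}\{i:x_i=\alpha\}-\mathrm{Card}\{i:x_i=-\alpha\}$ for $\alpha>0$: $\mathop{\boxplus}_{i\in I}x_i=0$ if $\xi(\alpha)=0$ for all $\alpha>0$; otherwise, with $\alpha^\star$ the largest $\alpha>0$ such that $\xi(\alpha)\ne0$, $\mathop{\boxplus}_{i\in I}x_i=\alpha^\star$ if $\xi(\alpha^\star)>0$ and $-\alpha^\star$ if $\xi(\alpha^\star)<0$. $A\boxtimes v$ is the vector with $i$-th component $\mathop{\boxplus}_{j\in[n]}a_{i,j}v_j$ (for $A$, $v$ nonnegative this is $\max_ja_{i,j}v_j$). $\lambda>0$ is a $\boxtimes$-eigenvalue of $A$ if there is $v\in\mathbb R_+^n\setminus\{0\}$ with $A\boxtimes v=\lambda v$. For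 a natural number $p$, $\Phi_p(A)=(a_{i,j}^{2p+1})_{i,j}$ and $\rho_A^{(p)}=(\rho_{\Phi_p(A)})^{1/(2p+1)}$, where $\rho_{\Phi_p(A)}$ is the spectral radius (Perron–Frobenius eigenvalue) of $\Phi_p(A)$. Let $T$ be the set of triples $(k,h,\sigma)$ with $k\in\{0,1,\dots,n\}$, $h=\{h_1<\dots<h_k\}\subset[n]$ and $\sigma$ a permutation of $\{h_1,\dots,h_k\}$, and put $m_{k,h,\sigma}(\lambda)=(-1)^{n-k}\operatorname{sgn}(\sigma)\big(\prod_{i\in h}a_{i,\sigma(i)}\big)\lambda^{n-k}$ (empty product $=1$). Let $\stackrel{-}{\smile},\stackrel{+}{\smile}$ be the associative (and commutative) operations on $\mathbb R$: $u\stackrel{\mp}{\smile}v$ equals $u$ if $|u|>|v|$, equals $v$ if $|u|<|v|$, and if $|u|=|v|$ then $u\stackrel{-}{\smile}v=\min\{u,v\}$, $u\stackrel{+}{\smile}v=\max\{u,v\}$. $P_{A,-}^{(\infty)}(\lambda)$ and $P_{A,+}^{(\infty)}(\lambda)$ are the results of combining all the $m_{k,h,\sigma}(\lambda)$, $(k,h,\sigma)\in T$, by $\stackrel{-}{\smile}$ and by $\stackrel{+}{\smile}$ respectively. *)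

theory Defs
  imports "Jordan_Normal_Form.Spectral_Radius" "HOL-Combinatorics.Permutations"
begin

text \<open>Rows and columns of an n by n matrix are indexed by \<open>{0..<n}\<close> instead of \<open>{1..n}\<close>.\<close>

definition boxplus_xi :: "'i set \<Rightarrow> ('i \<Rightarrow> real) \<Rightarrow> real \<Rightarrow> int" where
  "boxplus_xi I x \<alpha> = int (card {i \<in> I. x i = \<alpha>}) - int (card {i \<in> I. x i = - \<alpha>})"

definition boxplus :: "'i set \<Rightarrow> ('i \<Rightarrow> real) \<Rightarrow> real" where
  "boxplus I x =
     (if \<forall>\<alpha>>0. boxplus_xi I x \<alpha> = 0 then 0
      else let a = Max {\<alpha>. 0 < \<alpha> \<and> boxplus_xi I x \<alpha> \<noteq> 0}
           in if boxplus_xi I x a > 0 then a else - a)"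

definition boxtimes :: "real mat \<Rightarrow> real vec \<Rightarrow> real vec" where
  "boxtimes A v = vec (dim_row A) (\<lambda>i. boxplus {0..<dim_col A} (\<lambda>j. A $$ (i, j) * v $ j))"

definition boxtimes_eigenvalue :: "real mat \<Rightarrow> real \<Rightarrow> bool" where
  "boxtimes_eigenvalue A \<mu> \<longleftrightarrow>
     0 < \<mu> \<and>
     (\<exists>v \<in> carrier_vec (dim_col A).
        (\<forall>i < dim_col A. 0 \<le> v $ i) \<and> v \<noteq> 0\<^sub>v (dim_col A) \<and> boxtimes A v = \<mu> \<cdot>\<^sub>v v)"

definition Phi :: "nat \<Rightarrow> real mat \<Rightarrow> real mat" where
  "Phi p A = map_mat (\<lambda>a. a ^ (2 * p + 1)) A"

definition rho :: "nat \<Rightarrow> real mat \<Rightarrow> real" where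
  "rho p A = root (2 * p + 1) (spectral_radius (map_mat complex_of_real (Phi p A)))"

definition smile_minus :: "real \<Rightarrow> real \<Rightarrow> real" where
  "smile_minus u v =
     (if \<bar>v\<bar> < \<bar>u\<bar> then u else if \<bar>u\<bar> < \<bar>v\<bar> then v else min u v)"

definition smile_plus :: "real \<Rightarrow> real \<Rightarrow> real" where
  "smile_plus u v =
     (if \<bar>v\<bar> < \<bar>u\<bar> then u else if \<bar>u\<bar> < \<bar>v\<bar> then v else max u v)"

text \<open>Both operations form commutative monoids with neutral element 0, so they extend to
  finite families in the same way as \<open>sum\<close> extends addition.\<close>

global_interpretation Smile_minus: comm_monoid_set smile_minus 0
  defines Smile_minus = Smile_minus.F
  by standard (auto simp: smile_minus_def min_def split: if_splits)

global_interpretation Smile_plus: comm_monoid_set smile_plus 0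
  defines Smile_plus = Smile_plus.F
  by standard (auto simp: smile_plus_def max_def split: if_splits)

text \<open>A permutation of \<open>h\<close> is represented by its extension by the identity outside \<open>h\<close>,
  which has the same sign.\<close>

definition perm_triples :: "nat \<Rightarrow> (nat \<times> nat set \<times> (nat \<Rightarrow> nat)) set" where
  "perm_triples n = {(k, h, \<sigma>). k \<le> n \<and> h \<subseteq> {0..<n} \<and> card h = k \<and> \<sigma> permutes h}"

definition char_monomial :: "real mat \<Rightarrow> real \<Rightarrow> nat \<times> nat set \<times> (nat \<Rightarrow> nat) \<Rightarrow> real" where
  "char_monomial A \<mu> = (\<lambda>(k, h, \<sigma>).
     (-1) ^ (dim_row A - k) * of_int (sign \<sigma>) * (\<Prod>i\<in>h. A $$ (i, \<sigma> i)) * \<mu> ^ (dim_row A - k))"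

definition P_minus :: "real mat \<Rightarrow> real \<Rightarrow> real" where
  "P_minus A \<mu> = Smile_minus (char_monomial A \<mu>) (perm_triples (dim_row A))"

definition P_plus :: "real mat \<Rightarrow> real \<Rightarrow> real" where
  "P_plus A \<mu> = Smile_plus (char_monomial A \<mu>) (perm_triples (dim_row A))"

end

theory Submission
  imports Defs "HOL-Analysis.Function_Topology" "HOL-Combinatorics.Cycles"
begin

text \<open>
  For nonnegative entries \<open>\<boxplus>\<close> is the maximum, so the eigenvalue problem reads
  \<open>max\<^sub>j a\<^sub>i\<^sub>j v\<^sub>j = c v\<^sub>i\<close>. Everything is compared with one number \<open>c\<close>, the largest geometric mean
  of the entries along a cycle, which is characterised here by the existence of a positive \<open>v\<close>
  solving this equation.

  Existence (\<open>max_eigen_exists\<close>): among all \<open>c\<close> for which some positive \<open>v\<close> satisfies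
  \<open>a\<^sub>i\<^sub>j v\<^sub>j \<le> c v\<^sub>i\<close> for all \<open>i, j\<close>, there is a least one, because positivity of the entries confines
  normalised \<open>v\<close> to a compact box. At the least \<open>c\<close> some inequalities cannot be relaxed, and they
  carry a set of rows that is mapped into itself by suitable equality arcs. This set prevents the
  infimum of the subeigenvectors bounded below on it from collapsing to 0, and the infimum is an
  eigenvector.

  The polynomials: multiplying \<open>a\<^sub>i\<^sub>j v\<^sub>j \<le> c v\<^sub>i\<close> along a permutation of \<open>h\<close> cancels \<open>v\<close> and gives
  \<open>\<Prod> a\<^sub>i\<^sub>,\<^sub>\<sigma>\<^sub>i \<le> c ^ card h\<close>. Hence at \<open>\<lambda> = c\<close> all monomials have modulus at most \<open>c ^ n\<close>. The empty
  permutation attains it with sign \<open>(-1) ^ n\<close>. Following equality arcs one closes a cycle, say of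
  length \<open>k\<close>, which attains it with sign \<open>(-1) ^ (n - k) * (-1) ^ (k - 1) = - (-1) ^ n\<close>. Since
  \<open>P_minus + P_plus\<close> vanishes when the maximal modulus occurs with both signs, it
  vanishes at \<open>c\<close>. For \<open>\<lambda> > c\<close> the empty permutation strictly dominates, so the sum is nonzero.
  Thus \<open>c\<close> is the largest zero.

  The limit: the vector of entries \<open>v\<^sub>i ^ r\<close>, \<open>r = 2 p + 1\<close>, tests the nonnegative matrix
  \<open>Phi p A\<close>. Each of its row sums lies between its largest summand \<open>c ^ r v\<^sub>i ^ r\<close> and \<open>n\<close> times
  that, so the spectral radius lies between \<open>c ^ r\<close> and \<open>n c ^ r\<close>, and taking \<open>r\<close>-th roots
  squeezes \<open>rho p A\<close> to \<open>c\<close>.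
\<close>

section \<open>Eigenvectors of positive matrices in the max-times semiring\<close>

definition max_subeigen :: "nat \<Rightarrow> (nat \<Rightarrow> nat \<Rightarrow> real) \<Rightarrow> real \<Rightarrow> (nat \<Rightarrow> real) \<Rightarrow> bool" where
  "max_subeigen n a c v \<longleftrightarrow> (\<forall>i<n. \<forall>j<n. a i j * v j \<le> c * v i)"

definition tight_rows :: "nat \<Rightarrow> (nat \<Rightarrow> nat \<Rightarrow> real) \<Rightarrow> real \<Rightarrow> (nat \<Rightarrow> real) \<Rightarrow> nat set" where
  "tight_rows n a c v = {i. i < n \<and> (\<exists>j<n. a i j * v j = c * v i)}"

definition max_eigen :: "nat \<Rightarrow> (nat \<Rightarrow> nat \<Rightarrow> real) \<Rightarrow> real \<Rightarrow> (nat \<Rightarrow> real) \<Rightarrow> bool" where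
  "max_eigen n a c v \<longleftrightarrow> (\<forall>i<n. 0 < v i) \<and> max_subeigen n a c v \<and> tight_rows n a c v = {..<n}"

lemma compact_real_box:
  "compact (PiE UNIV (\<lambda>_::nat. {l..u::real}))"
  by (metis compactin_euclidean_iff compactin_PiE compact_Icc euclidean_product_topology)

text \<open>
  The least subeigenvalue exists by compactness. Let \<open>m\<close> and \<open>M\<close> be the smallest and largest entry.
  The constant vector shows that \<open>M\<close> is admissible, so only \<open>c \<le> M\<close> matter; for these a solution
  scaled to have maximum 1 has all coordinates at least \<open>m / M\<close>. The pairs \<open>(v, c)\<close> to be
  considered therefore form a compact set.
\<close>

lemma least_max_subeigenvalue:
  fixes a :: "nat \<Rightarrow> nat \<Rightarrow> real"
  assumes n: "1 \<le> n" and pos: "\<And>i j. i < n \<Longrightarrow> j < n \<Longrightarrow> 0 < a i j"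
  obtains c v where "0 < c" "\<forall>i<n. 0 < v i" "max_subeigen n a c v"
    "\<forall>d w. (\<forall>i<n. 0 < w i) \<and> max_subeigen n a d w \<longrightarrow> c \<le> d"
proof -
  define E where "E = (\<lambda>(i, j). a i j) ` ({..<n} \<times> {..<n})"
  have E: "finite E" "E \<noteq> {}"
    using n by (auto simp: E_def lessThan_empty_iff)
  define m M where "m = Min E" and "M = Max E"
  have mM: "m \<le> a i j" "a i j \<le> M" if "i < n" "j < n" for i j
    using that E unfolding m_def M_def by (auto simp: E_def intro!: Min_le Max_ge)
  have m0: "0 < m"
    unfolding m_def using E pos by (subst Min_gr_iff) (auto simp: E_def)
  have "m \<le> M" using E m_def M_def by simp
  define \<delta> where "\<delta> = m / M"
  have \<delta>: "0 < \<delta>" "\<delta> \<le> 1"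
    using m0 \<open>m \<le> M\<close> by (auto simp: \<delta>_def)
  define B :: "((nat \<Rightarrow> real) \<times> real) set" where "B = PiE UNIV (\<lambda>_. {\<delta>..1}) \<times> {0..M}"
  define S where "S = B \<inter> {(v, c). max_subeigen n a c v}"
  have cont: "continuous_on UNIV (\<lambda>x::(nat \<Rightarrow> real) \<times> real. fst x i)" for i
    by (rule continuous_on_compose2[OF continuous_on_product_coordinates]) (auto intro: continuous_intros)
  have "closed {x. a i j * fst x j \<le> snd x * fst x i}" for i j
    by (intro closed_Collect_le continuous_intros cont)
  moreover have "{(v, c). max_subeigen n a c v}
      = (\<Inter>i\<in>{..<n}. \<Inter>j\<in>{..<n}. {x. a i j * fst x j \<le> snd x * fst x i})"
    by (auto simp: max_subeigen_def)
  ultimately have "closed {(v, c). max_subeigen n a c v}"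
    by (auto intro!: closed_INT)
  moreover have "compact B"
    unfolding B_def by (intro compact_Times compact_real_box compact_Icc)
  ultimately have "compact S"
    unfolding S_def by (rule compact_Int_closed[rotated])
  moreover have "((\<lambda>_. 1), M) \<in> S"
    using mM \<delta> m0 \<open>m \<le> M\<close> by (auto simp: S_def B_def max_subeigen_def)
  ultimately obtain x where x: "x \<in> S" "\<And>y. y \<in> S \<Longrightarrow> snd x \<le> snd y"
    using continuous_attains_inf[of S snd] continuous_on_snd[OF continuous_on_id] by blast
  obtain v c where vc: "x = (v, c)" by force
  have v: "\<delta> \<le> v i" "v i \<le> 1" for i
    using x(1) by (auto simp: vc S_def B_def PiE_iff)
  have sub: "max_subeigen n a c v" and "c \<le> M"
    using x(1) by (auto simp: vc S_def B_def)
  have posd: "0 < d" if w: "\<forall>i<n. 0 < w i" "max_subeigen n a d w" for d w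
  proof -
    have "0 < a 0 0 * w 0" using n w pos by simp
    also have "\<dots> \<le> d * w 0" using n w by (auto simp: max_subeigen_def)
    finally show ?thesis using n w by (simp add: zero_less_mult_iff order_less_not_sym)
  qed
  have vpos: "\<forall>i<n. 0 < v i" using v \<delta> by (meson less_le_trans)
  show ?thesis
  proof (rule that[OF posd[OF vpos sub] vpos sub], intro allI impI, elim conjE)
    fix d w assume w: "\<forall>i<n. 0 < w i" "max_subeigen n a d w"
    show "c \<le> d"
    proof (rule ccontr)
      assume "\<not> c \<le> d"
      then have "d \<le> M" using \<open>c \<le> M\<close> by simp
      have "0 < d" using posd w by blast
      define W where "W = Max (w ` {..<n})"
      have fin: "finite (w ` {..<n})" "w ` {..<n} \<noteq> {}" using n by (auto simp: lessThan_empty_iff)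
      obtain k where k: "k < n" "W = w k" using Max_in[OF fin] unfolding W_def by auto
      have W: "w i \<le> W" if "i < n" for i using that fin unfolding W_def by simp
      have W0: "0 < W" using k w by simp
      define u where "u = (\<lambda>i. if i < n then w i / W else 1)"
      have "\<delta> \<le> w i / W" if i: "i < n" for i
      proof -
        have "m * W \<le> a i k * w k" using mM[OF i k(1)] k W0 by (simp add: mult_right_mono)
        also have "\<dots> \<le> d * w i" using w(2) i k by (auto simp: max_subeigen_def)
        also have "\<dots> \<le> M * w i" using \<open>d \<le> M\<close> w i by (simp add: mult_right_mono)
        finally show ?thesis using W0 m0 \<open>m \<le> M\<close> by (simp add: \<delta>_def field_simps)
      qed
      then have "(u, d) \<in> S"
        using W W0 \<delta> w(2) \<open>0 < d\<close> \<open>d \<le> M\<close>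
        by (auto simp: S_def B_def u_def max_subeigen_def field_simps)
      from x(2)[OF this] show False using \<open>\<not> c \<le> d\<close> by (simp add: vc)
    qed
  qed
qed

text \<open>
  Finitely many strict inequalities survive a common small reduction of their right-hand sides. This
  is what allows rows without equality to be perturbed.
\<close>

lemma uniform_slack:
  fixes a :: "nat \<Rightarrow> nat \<Rightarrow> real"
  assumes "finite X" and "\<And>i j. i \<in> X \<Longrightarrow> j < n \<Longrightarrow> a i j * v j < c * v i"
  obtains \<theta> :: real where "0 < \<theta>" "\<theta> < 1" "\<forall>i\<in>X. \<forall>j<n. a i j * v j < c * (\<theta> * v i)"
proof -
  have "eventually (\<lambda>\<theta>. a i j * v j < c * (\<theta> * v i)) (at_left 1)" if "i \<in> X" "j < n" for i j
  proof -
    have "((\<lambda>\<theta>::real. c * (\<theta> * v i)) \<longlongrightarrow> c * (1 * v i)) (at_left 1)"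
      by (intro tendsto_intros)
    then show ?thesis by (rule order_tendstoD) (use assms that in simp)
  qed
  then have "\<forall>i\<in>X. \<forall>j\<in>{..<n}. eventually (\<lambda>\<theta>. a i j * v j < c * (\<theta> * v i)) (at_left 1)"
    by simp
  then have "eventually (\<lambda>\<theta>. \<forall>i\<in>X. \<forall>j\<in>{..<n}. a i j * v j < c * (\<theta> * v i)) (at_left 1)"
    using assms(1) by (intro eventually_ball_finite ballI) auto
  moreover have "eventually (\<lambda>\<theta>::real. \<theta> \<in> {0<..<1}) (at_left 1)"
    by (rule eventually_at_left_real) simp
  ultimately have "eventually (\<lambda>\<theta>. (\<forall>i\<in>X. \<forall>j\<in>{..<n}. a i j * v j < c * (\<theta> * v i))
      \<and> \<theta> \<in> {0<..<1}) (at_left 1)"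
    by (rule eventually_conj)
  from eventually_happens'[OF trivial_limit_at_left_real this] show ?thesis
    using that by auto
qed

text \<open>
  Choose a subeigenvector for the least \<open>c\<close> with as few tight rows as possible. With no tight row,
  \<open>c\<close> could be decreased. If a tight row had all its equality arcs leading to rows that are not tight,
  then shrinking the coordinates outside the tight set slightly would make that row strict and no
  other row tight, contradicting the choice.
\<close>

lemma closed_tight_set:
  fixes a :: "nat \<Rightarrow> nat \<Rightarrow> real"
  assumes pos: "\<And>i j. i < n \<Longrightarrow> j < n \<Longrightarrow> 0 < a i j" and c: "0 < c"
    and v0: "\<forall>i<n. 0 < v0 i" "max_subeigen n a c v0"
    and least: "\<forall>d w. (\<forall>i<n. 0 < w i) \<and> max_subeigen n a d w \<longrightarrow> c \<le> d"
  obtains v where "\<forall>i<n. 0 < v i" "max_subeigen n a c v" "tight_rows n a c v \<noteq> {}"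
    "\<forall>i \<in> tight_rows n a c v. \<exists>j \<in> tight_rows n a c v. a i j * v j = c * v i"
proof -
  define Q where "Q v \<longleftrightarrow> (\<forall>i<n. 0 < v i) \<and> max_subeigen n a c v" for v :: "nat \<Rightarrow> real"
  obtain v where Qv: "Q v" and min: "\<And>w. Q w \<Longrightarrow> card (tight_rows n a c v) \<le> card (tight_rows n a c w)"
    using ex_has_least_nat[of Q v0 "\<lambda>v. card (tight_rows n a c v)"] v0 Q_def by blast
  define T where "T = tight_rows n a c v"
  have finT: "finite T" and Tn: "T \<subseteq> {..<n}" by (auto simp: T_def tight_rows_def)
  have v: "0 < v i" if "i < n" for i using that Qv by (simp add: Q_def)
  have sub: "a i j * v j \<le> c * v i" if "i < n" "j < n" for i j
    using that Qv by (simp add: Q_def max_subeigen_def)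
  have strict: "a i j * v j < c * v i" if "i \<in> {..<n} - T" "j < n" for i j
    using that sub[of i j] by (fastforce simp: T_def tight_rows_def)
  obtain \<theta> where \<theta>: "0 < \<theta>" "\<theta> < 1"
      and slack': "\<forall>i\<in>{..<n} - T. \<forall>j<n. a i j * v j < c * (\<theta> * v i)"
    by (rule uniform_slack[of "{..<n} - T" n a v c]) (use strict in auto)
  have slack: "a i j * v j < c * (\<theta> * v i)" if "i \<in> {..<n} - T" "j < n" for i j
    using slack' that by blast
  show ?thesis
  proof (rule that[of v])
    show "\<forall>i<n. 0 < v i" "max_subeigen n a c v" using Qv by (auto simp: Q_def)
    \<comment> \<open>Otherwise \<open>\<theta>\<close> is a common slack for all rows, and \<open>c * \<theta> < c\<close> is a subeigenvalue.\<close>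
    show "tight_rows n a c v \<noteq> {}"
    proof
      assume "tight_rows n a c v = {}"
      then have "max_subeigen n a (c * \<theta>) v"
        using slack by (auto simp: max_subeigen_def T_def mult.assoc less_imp_le)
      then have "c \<le> c * \<theta>" using least Qv by (auto simp: Q_def)
      then show False using c \<theta> by simp
    qed
  next
    show "\<forall>i \<in> tight_rows n a c v. \<exists>j \<in> tight_rows n a c v. a i j * v j = c * v i"
    proof
      fix i assume i: "i \<in> tight_rows n a c v"
      show "\<exists>j \<in> tight_rows n a c v. a i j * v j = c * v i"
      proof (rule ccontr)
        assume no: "\<not> (\<exists>j \<in> tight_rows n a c v. a i j * v j = c * v i)"
        define w where "w k = (if k \<in> T then v k else \<theta> * v k)" for k
        have wv: "w k \<le> v k" if "k < n" for k using v[OF that] \<theta> by (simp add: w_def)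
        have row: "a k j * w j \<le> c * w k" if "k < n" "j < n" for k j
        proof -
          have "a k j * w j \<le> a k j * v j" using wv pos that by (simp add: less_imp_le)
          also have "\<dots> \<le> c * w k"
            using sub[OF that] slack[of k j] that by (auto simp: w_def)
          finally show ?thesis .
        qed
        have "Q w" using row v \<theta> by (auto simp: Q_def max_subeigen_def w_def)
        have tight: "k \<in> T - {i}" if k: "k \<in> tight_rows n a c w" for k
        proof -
          obtain j where j: "k < n" "j < n" "a k j * w j = c * w k"
            using k by (auto simp: tight_rows_def)
          have le: "a k j * w j \<le> a k j * v j"
            using wv[OF j(2)] pos[OF j(1,2)] by (intro mult_left_mono) auto
          have "k \<in> T"
          proof (rule ccontr)
            assume "k \<notin> T"
            then have "a k j * v j < c * w k" using slack[of k j] j by (simp add: w_def)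
            then show False using le j(3) by simp
          qed
          moreover have "k \<noteq> i"
          proof
            assume "k = i"
            then have eq: "a i j * w j = c * v i" using j(3) \<open>k \<in> T\<close> by (simp add: w_def)
            then have "a i j * v j = c * v i" using le sub[of i j] j \<open>k = i\<close> by simp
            then have "j \<notin> T" using no by (auto simp: T_def)
            then have "w j < v j" using v[OF j(2)] \<theta> by (simp add: w_def)
            then have "a i j * w j < a i j * v j"
              using pos[of i j] j \<open>k = i\<close> by (intro mult_strict_left_mono) auto
            then show False using eq \<open>a i j * v j = c * v i\<close> by simp
          qed
          ultimately show ?thesis by simp
        qed
        have "card (tight_rows n a c w) \<le> card (T - {i})"
          using tight finT by (intro card_mono) auto
        also have "\<dots> < card T" using i finT by (intro psubset_card_mono) (auto simp: T_def)
        finally show False using min[OF \<open>Q w\<close>] by (simp add: T_def)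
      qed
    qed
  qed
qed

text \<open>
  Let \<open>u\<close> be the pointwise infimum of the nonnegative subeigenvectors that are at least \<open>v\<close> on the
  closed tight set \<open>T\<close>. It is such a subeigenvector itself, and the bound on \<open>T\<close> together with
  positive entries makes it positive everywhere. A row of \<open>u\<close> without equality would allow its
  coordinate to be lowered alone, which contradicts minimality; the bound on \<open>T\<close> is not violated,
  because the equality arc of \<open>v\<close> that stays in \<open>T\<close> forces it.
\<close>

theorem max_eigen_exists:
  fixes a :: "nat \<Rightarrow> nat \<Rightarrow> real"
  assumes n: "1 \<le> n" and pos: "\<And>i j. i < n \<Longrightarrow> j < n \<Longrightarrow> 0 < a i j"
  obtains c u where "0 < c" "max_eigen n a c u"
proof -
  obtain c v0 where c: "0 < c" and v0: "\<forall>i<n. 0 < v0 i" "max_subeigen n a c v0"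
    and least: "\<forall>d w. (\<forall>i<n. 0 < w i) \<and> max_subeigen n a d w \<longrightarrow> c \<le> d"
    by (rule least_max_subeigenvalue[where a = a, OF n pos])
  obtain v where v: "\<forall>i<n. 0 < v i" "max_subeigen n a c v" and ne: "tight_rows n a c v \<noteq> {}"
    and arc: "\<forall>i \<in> tight_rows n a c v. \<exists>j \<in> tight_rows n a c v. a i j * v j = c * v i"
    by (rule closed_tight_set[OF pos c v0 least])
  define T where "T = tight_rows n a c v"
  have Tn: "i < n" if "i \<in> T" for i using that by (simp add: T_def tight_rows_def)
  define W where "W = {w. (\<forall>i<n. 0 \<le> w i) \<and> max_subeigen n a c w \<and> (\<forall>i\<in>T. v i \<le> w i)}"
  define u where "u i = (INF w\<in>W. w i)" for i
  have vW: "v \<in> W" using v by (auto simp: W_def less_imp_le)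
  have bdd: "bdd_below ((\<lambda>w. w i) ` W)" if "i < n" for i
    using that by (auto simp: bdd_below_def W_def)
  have lower: "u i \<le> w i" if "i < n" "w \<in> W" for i w
    unfolding u_def using that bdd by (intro cINF_lower) auto
  have greatest: "x \<le> u i" if "\<And>w. w \<in> W \<Longrightarrow> x \<le> w i" for x i
    unfolding u_def using that vW by (intro cINF_greatest) auto
  have u0: "0 \<le> u i" if "i < n" for i
    using that by (intro greatest) (auto simp: W_def)
  have sub: "a i j * u j \<le> c * u i" if ij: "i < n" "j < n" for i j
  proof -
    have "a i j * u j / c \<le> u i"
    proof (rule greatest)
      fix w assume w: "w \<in> W"
      have "a i j * u j \<le> a i j * w j" using lower[OF ij(2) w] pos[OF ij] by simp
      also have "\<dots> \<le> c * w i" using w ij by (auto simp: W_def max_subeigen_def)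
      finally show "a i j * u j / c \<le> w i" using c by (simp add: field_simps)
    qed
    then show ?thesis using c by (simp add: field_simps)
  qed
  have uT: "v i \<le> u i" if "i \<in> T" for i
    using that by (intro greatest) (auto simp: W_def)
  have u_pos: "0 < u i" if i: "i < n" for i
  proof -
    obtain t where t: "t \<in> T" using ne T_def by blast
    then have "0 < u t" using uT[OF t] v(1) Tn[OF t] by fastforce
    then have "0 < a i t * u t" using pos[OF i Tn[OF t]] by simp
    also have "\<dots> \<le> c * u i" using sub i Tn[OF t] by blast
    finally show ?thesis using c by (simp add: zero_less_mult_iff)
  qed
  have tight: "\<exists>j<n. a i j * u j = c * u i" if i: "i < n" for i
  proof (rule ccontr)
    assume "\<not> ?thesis"
    then have strict: "a i j * u j < c * u i" if "j < n" for j
      using that sub[OF i that] by fastforce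
    obtain \<theta> where \<theta>: "0 < \<theta>" "\<theta> < 1" and slack': "\<forall>k\<in>{i}. \<forall>j<n. a k j * u j < c * (\<theta> * u k)"
      by (rule uniform_slack[of "{i}" n a u c]) (use strict in auto)
    have slack: "a i j * u j < c * (\<theta> * u i)" if "j < n" for j
      using slack' that by blast
    define w where "w = u(i := \<theta> * u i)"
    have wu: "w j \<le> u j" if "j < n" for j
      using u_pos[OF that] \<theta> mult_right_mono[of \<theta> 1 "u j"] by (auto simp: w_def)
    have "a k j * w j \<le> c * w k" if kj: "k < n" "j < n" for k j
    proof -
      have "a k j * w j \<le> a k j * u j" using wu[OF kj(2)] pos[OF kj] by simp
      also have "\<dots> \<le> c * w k" using sub[OF kj] slack[OF kj(2)] by (auto simp: w_def)
      finally show ?thesis .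
    qed
    moreover have "v k \<le> w k" if k: "k \<in> T" for k
    proof (cases "k = i")
      case True
      obtain j where j: "j \<in> T" "a i j * v j = c * v i"
        using arc k True by (auto simp: T_def)
      have "c * v i \<le> a i j * u j" using j uT[OF j(1)] pos[OF i Tn[OF j(1)]] by (metis mult_left_mono less_imp_le)
      also have "\<dots> \<le> c * w i" using slack[OF Tn[OF j(1)]] by (simp add: w_def)
      finally show ?thesis using c True by simp
    next
      case False then show ?thesis using uT[OF k] by (simp add: w_def)
    qed
    ultimately have "w \<in> W"
      using u0 u_pos \<theta> i by (auto simp: W_def max_subeigen_def w_def)
    from lower[OF i this] show False using u_pos[OF i] \<theta> by (simp add: w_def)
  qed
  have "max_eigen n a c u"
    using u_pos sub tight by (auto simp: max_eigen_def max_subeigen_def tight_rows_def)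
  then show ?thesis using that c by blast
qed


section \<open>Cyclic permutations in self-maps of finite sets\<close>

lemma exists_periodic_point:
  fixes f :: "nat \<Rightarrow> nat"
  assumes "1 \<le> n" and "\<And>i. i < n \<Longrightarrow> f i < n"
  obtains x k where "x < n" "0 < k" "(f ^^ k) x = x"
proof -
  have range: "(f ^^ k) 0 < n" for k
    using assms by (induction k) auto
  have "\<not> inj (\<lambda>k. (f ^^ k) 0)"
  proof
    assume "inj (\<lambda>k. (f ^^ k) 0)"
    then have "infinite (range (\<lambda>k. (f ^^ k) 0))" by (rule range_inj_infinite)
    moreover have "range (\<lambda>k. (f ^^ k) 0) \<subseteq> {..<n}" using range by auto
    ultimately show False using finite_subset by blast
  qed
  then obtain i j where "i < j" "(f ^^ i) 0 = (f ^^ j) 0"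
    by (metis (mono_tags, lifting) injI linorder_neqE_nat)
  then have "(f ^^ (j - i)) ((f ^^ i) 0) = (f ^^ i) 0"
    by (metis funpow_add le_add_diff_inverse2 less_imp_le o_apply)
  then show ?thesis using that[OF range, of "j - i" i] \<open>i < j\<close> by simp
qed

lemma sign_cycle_of_list:
  "distinct cs \<Longrightarrow> sign (cycle_of_list cs) = (-1) ^ (length cs - 1)"
proof (induction cs rule: cycle_of_list.induct)
  case (1 i j cs)
  then show ?case
    by (simp add: sign_compose[OF permutation_swap_id permutation_of_cycle] sign_swap_id del: o_apply comp_apply)
qed (auto simp: sign_id)

text \<open>
  A self-map of a finite set has a periodic point; on the orbit of that point it is a cycle, so its
  sign is determined by the length of the orbit.
\<close>

lemma cyclic_permutation_of_self_map:
  fixes f :: "nat \<Rightarrow> nat"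
  assumes n: "1 \<le> n" and f: "\<And>i. i < n \<Longrightarrow> f i < n"
  obtains h \<sigma> where "h \<subseteq> {..<n}" "h \<noteq> {}" "\<sigma> permutes h" "\<forall>i\<in>h. \<sigma> i = f i"
    "sign \<sigma> = (-1) ^ (card h - 1)"
proof -
  obtain x m where xm: "x < n" "0 < m" "(f ^^ m) x = x"
    by (rule exists_periodic_point[OF n f])
  define k where "k = least_power f x"
  have k: "0 < k" "(f ^^ k) x = x" using least_powerI xm by (auto simp: k_def)
  have k_le: "k \<le> l" if "(f ^^ l) x = x" "0 < l" for l
    using least_power_le that by (auto simp: k_def)
  define cs where "cs = map (\<lambda>i. (f ^^ i) x) [0..<k]"
  have no_repeat: False if "i < j" "j < k" "(f ^^ i) x = (f ^^ j) x" for i j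
  proof -
    have "(f ^^ (k - j + i)) x = (f ^^ (k - j)) ((f ^^ j) x)"
      using that by (simp only: funpow_add o_apply)
    also have "\<dots> = (f ^^ (k - j + j)) x" by (simp only: funpow_add o_apply)
    also have "\<dots> = x" using that k by simp
    finally show False using k_le[of "k - j + i"] that by simp
  qed
  then have inj: "inj_on (\<lambda>i. (f ^^ i) x) {0..<k}"
    by (intro inj_onI) (metis atLeastLessThan_iff linorder_neqE_nat)
  then have dist: "distinct cs" by (simp add: cs_def distinct_map)
  have len: "length cs = k" by (simp add: cs_def)
  have "map (cycle_of_list cs) cs = rotate1 cs"
    using cyclic_rotation[OF dist, of 1] by simp
  also have "\<dots> = map f cs"
  proof (rule nth_equalityI)
    fix i assume i: "i < length (rotate1 cs)"
    show "rotate1 cs ! i = map f cs ! i"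
    \<comment> \<open>In the last position the rotation returns to \<open>x = (f ^^ k) x\<close>.\<close>
    proof (cases "Suc i = k")
      case True then show ?thesis using i k by (auto simp: nth_rotate1 len cs_def)
    next
      case False then show ?thesis using i k by (simp add: nth_rotate1 len cs_def)
    qed
  qed simp
  finally have step: "cycle_of_list cs i = f i" if "i \<in> set cs" for i
    using that by simp
  have "(f ^^ i) x < n" for i using xm(1) f by (induction i) auto
  then have "set cs \<subseteq> {..<n}" by (auto simp: cs_def)
  moreover have "set cs \<noteq> {}" using k by (simp add: cs_def)
  moreover have "sign (cycle_of_list cs) = (-1) ^ (card (set cs) - 1)"
    using sign_cycle_of_list[OF dist] distinct_card[OF dist] by simp
  ultimately show ?thesis using that[of "set cs" "cycle_of_list cs"] cycle_permutes[of cs] step by blast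
qed

section \<open>The operations that keep the term of largest modulus\<close>

lemma smile_minus_values:
  "smile_minus u v = u \<or> smile_minus u v = v"
  "\<bar>u\<bar> \<le> \<bar>smile_minus u v\<bar>" "\<bar>v\<bar> \<le> \<bar>smile_minus u v\<bar>"
  "\<bar>u\<bar> = \<bar>smile_minus u v\<bar> \<Longrightarrow> smile_minus u v \<le> u"
  "\<bar>v\<bar> = \<bar>smile_minus u v\<bar> \<Longrightarrow> smile_minus u v \<le> v"
  by (auto simp: smile_minus_def split: if_splits)

lemma smile_plus_uminus: "smile_plus u v = - smile_minus (- u) (- v)"
  by (auto simp: smile_minus_def smile_plus_def min_def max_def)

text \<open>
  These properties determine the fold: it is the smallest among the terms of largest modulus.
\<close>

lemma Smile_minus_extremal:
  assumes "finite S" "S \<noteq> {}"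
  shows "Smile_minus g S \<in> g ` S"
    and "\<forall>x\<in>S. \<bar>g x\<bar> \<le> \<bar>Smile_minus g S\<bar>"
    and "\<forall>x\<in>S. \<bar>g x\<bar> = \<bar>Smile_minus g S\<bar> \<longrightarrow> Smile_minus g S \<le> g x"
proof -
  have "Smile_minus g S \<in> g ` S \<and> (\<forall>x\<in>S. \<bar>g x\<bar> \<le> \<bar>Smile_minus g S\<bar> \<and>
      (\<bar>g x\<bar> = \<bar>Smile_minus g S\<bar> \<longrightarrow> Smile_minus g S \<le> g x))"
    using assms
  proof (induction S rule: finite_ne_induct)
    case (singleton x)
    then show ?case by (auto simp: smile_minus_def)
  next
    case (insert x F)
    define s where "s = Smile_minus g F"
    have *: "Smile_minus g (insert x F) = smile_minus (g x) s"
      using insert by (simp add: s_def)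
    have IH: "s \<in> g ` F" "\<And>y. y \<in> F \<Longrightarrow> \<bar>g y\<bar> \<le> \<bar>s\<bar>" "\<And>y. y \<in> F \<Longrightarrow> \<bar>g y\<bar> = \<bar>s\<bar> \<Longrightarrow> s \<le> g y"
      using insert.IH by (auto simp: s_def)
    note sm = smile_minus_values[where u = "g x" and v = s]
    have "smile_minus (g x) s \<in> g ` insert x F" using sm(1) IH(1) by auto
    moreover have "\<bar>g y\<bar> \<le> \<bar>smile_minus (g x) s\<bar>" if "y \<in> insert x F" for y
      using that sm(2,3) IH(2)[of y] by (auto intro: order_trans)
    moreover have "smile_minus (g x) s \<le> g y"
      if "y \<in> insert x F" "\<bar>g y\<bar> = \<bar>smile_minus (g x) s\<bar>" for y
    proof (cases "y = x")
      case False
      then have "y \<in> F" using that by simp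
      then have "\<bar>g y\<bar> = \<bar>s\<bar>" using IH(2)[of y] sm(3) that(2) by linarith
      then show ?thesis using IH(3)[OF \<open>y \<in> F\<close>] sm(5) that(2) by linarith
    qed (use that sm in simp)
    ultimately show ?case unfolding * by blast
  qed
  then show "Smile_minus g S \<in> g ` S" "\<forall>x\<in>S. \<bar>g x\<bar> \<le> \<bar>Smile_minus g S\<bar>"
    "\<forall>x\<in>S. \<bar>g x\<bar> = \<bar>Smile_minus g S\<bar> \<longrightarrow> Smile_minus g S \<le> g x" by auto
qed

text \<open>Negation exchanges minima and maxima and so transfers the previous lemma to \<open>Smile_plus\<close>.\<close>

lemma Smile_plus_eq_Smile_minus:
  assumes "finite S"
  shows "Smile_plus g S = - Smile_minus (\<lambda>x. - g x) S"
  using assms by induction (auto simp: smile_plus_uminus)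

text \<open>
  If the largest modulus occurs with both signs, ties are broken to the negative value by one
  operation and to the positive value by the other, and the two results cancel.
\<close>

lemma smile_sum_zero_of_opposite:
  assumes S: "finite S" and xy: "x \<in> S" "y \<in> S" "g y = - g x"
    and dom: "\<And>z. z \<in> S \<Longrightarrow> \<bar>g z\<bar> \<le> \<bar>g x\<bar>"
  shows "Smile_minus g S + Smile_plus g S = 0"
proof -
  have ne: "S \<noteq> {}" using xy by auto
  have val: "Smile_minus f S = - \<bar>g x\<bar>" if f: "f = g \<or> f = (\<lambda>z. - g z)" for f
  proof -
    obtain z where z: "z \<in> S" "Smile_minus f S = f z" using Smile_minus_extremal(1)[OF S ne, of f] by auto
    have "\<bar>f x\<bar> \<le> \<bar>Smile_minus f S\<bar>" using Smile_minus_extremal(2)[OF S ne, of f] xy by blast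
    moreover have "\<bar>f z\<bar> \<le> \<bar>g x\<bar>" using f dom[OF z(1)] by auto
    ultimately have eq: "\<bar>Smile_minus f S\<bar> = \<bar>g x\<bar>" using z f by auto
    have "\<bar>f x\<bar> = \<bar>g x\<bar>" "\<bar>f y\<bar> = \<bar>g x\<bar>" "f y = - f x" using f xy by auto
    then have "Smile_minus f S \<le> f x" "Smile_minus f S \<le> f y"
      using Smile_minus_extremal(3)[OF S ne, of f] xy eq by auto
    then show ?thesis using eq \<open>\<bar>f x\<bar> = \<bar>g x\<bar>\<close> \<open>f y = - f x\<close> by linarith
  qed
  have "Smile_minus g S = - \<bar>g x\<bar>" "Smile_minus (\<lambda>z. - g z) S = - \<bar>g x\<bar>"
    by (auto intro: val)
  then show ?thesis using Smile_plus_eq_Smile_minus[OF S, of g] by simp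
qed

text \<open>On a single dominant term both operations agree, so their sum is twice that term.\<close>

lemma smile_sum_nonzero_of_dominant:
  assumes S: "finite S" and x: "x \<in> S" "g x \<noteq> 0"
    and dom: "\<And>z. z \<in> S \<Longrightarrow> z \<noteq> x \<Longrightarrow> \<bar>g z\<bar> < \<bar>g x\<bar>"
  shows "Smile_minus g S + Smile_plus g S \<noteq> 0"
proof -
  have ne: "S \<noteq> {}" using x by auto
  have val: "Smile_minus f S = f x" if f: "\<And>z. \<bar>f z\<bar> = \<bar>g z\<bar>" for f
  proof -
    obtain z where z: "z \<in> S" "Smile_minus f S = f z" using Smile_minus_extremal(1)[OF S ne, of f] by auto
    have "\<bar>f x\<bar> \<le> \<bar>f z\<bar>" using Smile_minus_extremal(2)[OF S ne, of f] x z by auto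
    then have "z = x" using dom[OF z(1)] f by fastforce
    then show ?thesis using z by simp
  qed
  have "Smile_minus g S = g x" "Smile_minus (\<lambda>z. - g z) S = - g x"
    using val[of g] val[of "\<lambda>z. - g z"] by auto
  then show ?thesis using Smile_plus_eq_Smile_minus[OF S, of g] x by simp
qed

text \<open>Nonnegative terms cannot cancel, so the largest term that occurs wins.\<close>

lemma boxplus_nonneg:
  assumes I: "finite I" "I \<noteq> {}" and x: "\<And>i. i \<in> I \<Longrightarrow> 0 \<le> x i"
  shows "boxplus I x = Max (x ` I)"
proof -
  have xi: "boxplus_xi I x \<alpha> = int (card {i \<in> I. x i = \<alpha>})" if "0 < \<alpha>" for \<alpha>
  proof -
    have none: "{i \<in> I. x i = - \<alpha>} = {}" using x that by force
    show ?thesis unfolding boxplus_xi_def none by simp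
  qed
  have xi_nz: "boxplus_xi I x \<alpha> \<noteq> 0 \<longleftrightarrow> \<alpha> \<in> x ` I" if "0 < \<alpha>" for \<alpha>
    using xi[OF that] I by auto
  have fin: "finite (x ` I)" "x ` I \<noteq> {}" using I by auto
  have max_nonneg: "0 \<le> Max (x ` I)" using Max_in[OF fin] x by auto
  show ?thesis
  proof (cases "\<forall>\<alpha>>0. boxplus_xi I x \<alpha> = 0")
    case True
    then have "\<not> 0 < Max (x ` I)" using xi_nz Max_in[OF fin] by blast
    then show ?thesis using True max_nonneg by (simp add: boxplus_def)
  next
    case False
    then obtain \<alpha> where "0 < \<alpha>" "\<alpha> \<in> x ` I" using xi_nz by blast
    then have pos: "0 < Max (x ` I)" using Max_ge[OF fin(1)] by (meson less_le_trans)
    have "{\<alpha>. 0 < \<alpha> \<and> boxplus_xi I x \<alpha> \<noteq> 0} = {\<alpha> \<in> x ` I. 0 < \<alpha>}"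
      using xi_nz by blast
    moreover have "Max {\<alpha> \<in> x ` I. 0 < \<alpha>} = Max (x ` I)"
      using fin pos Max_in[OF fin] by (intro Max_eqI) auto
    ultimately show ?thesis
      using False xi[OF pos] xi_nz[OF pos] Max_in[OF fin] unfolding boxplus_def Let_def by auto
  qed
qed


section \<open>Spectral radii of nonnegative matrices\<close>

text \<open>
  The Collatz--Wielandt upper bound: an eigenvector \<open>x\<close> is compared with \<open>w\<close> at an index where
  \<open>\<bar>x i\<bar> / w i\<close> is largest.
\<close>

lemma spectral_radius_le_of_subinvariant:
  fixes R :: "real mat" and w :: "nat \<Rightarrow> real"
  assumes R: "R \<in> carrier_mat n n" and n: "1 \<le> n"
    and nonneg: "\<And>i j. i < n \<Longrightarrow> j < n \<Longrightarrow> 0 \<le> R $$ (i, j)"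
    and w: "\<And>i. i < n \<Longrightarrow> 0 < w i"
    and sub: "\<And>i. i < n \<Longrightarrow> (\<Sum>j<n. R $$ (i, j) * w j) \<le> c * w i"
  shows "spectral_radius (map_mat complex_of_real R) \<le> c"
proof -
  let ?C = "map_mat complex_of_real R"
  have C: "?C \<in> carrier_mat n n" using R by simp
  obtain ev where ev: "ev \<in> spectrum ?C" and sr: "spectral_radius ?C = norm ev"
    using spectral_radius_mem_max(1)[OF C] n by auto
  then obtain x where x: "x \<in> carrier_vec n" "x \<noteq> 0\<^sub>v n" and eig: "?C *\<^sub>v x = ev \<cdot>\<^sub>v x"
    using R by (auto simp: spectrum_def eigenvalue_def eigenvector_def)
  define q where "q i = norm (x $ i) / w i" for i
  define t where "t = Max (q ` {..<n})"
  have fin: "finite (q ` {..<n})" "q ` {..<n} \<noteq> {}" using n by (auto simp: lessThan_empty_iff)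
  have qt: "q i \<le> t" if "i < n" for i using that fin by (simp add: t_def)
  have xt: "norm (x $ i) \<le> t * w i" if "i < n" for i
    using qt[OF that] w[OF that] by (simp add: q_def field_simps)
  obtain m where m: "m < n" "t = q m" using Max_in[OF fin] by (auto simp: t_def)
  obtain l where l: "l < n" "x $ l \<noteq> 0" using x by (auto simp: vec_eq_iff)
  then have "0 < q l" using w by (simp add: q_def)
  then have t0: "0 < t" using qt[OF l(1)] by simp
  have "ev * x $ m = (\<Sum>j<n. complex_of_real (R $$ (m, j)) * x $ j)"
    using arg_cong[OF eig, of "\<lambda>y. y $ m"] m(1) x(1) R
    by (simp add: scalar_prod_def lessThan_atLeast0)
  then have "norm ev * norm (x $ m) \<le> (\<Sum>j<n. norm (complex_of_real (R $$ (m, j)) * x $ j))"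
    by (metis norm_mult norm_sum)
  also have "\<dots> \<le> (\<Sum>j<n. R $$ (m, j) * (t * w j))"
    using nonneg[OF m(1)] xt by (intro sum_mono) (simp add: norm_mult mult_left_mono)
  also have "\<dots> = t * (\<Sum>j<n. R $$ (m, j) * w j)" by (simp add: sum_distrib_left algebra_simps)
  also have "\<dots> \<le> t * (c * w m)" using sub[OF m(1)] t0 by simp
  finally have "norm ev * (t * w m) \<le> c * (t * w m)"
    using m(2) w[OF m(1)] by (simp add: q_def field_simps)
  moreover have "0 < t * w m" using t0 w[OF m(1)] by simp
  ultimately show ?thesis unfolding sr by (simp only: mult_le_cancel_right_pos)
qed

text \<open>A nonnegative matrix preserves the inequality \<open>c w \<le> R w\<close>, so the inequality iterates.\<close>

lemma row_weight_pow_ge: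
  fixes R :: "real mat" and w :: "nat \<Rightarrow> real"
  assumes R: "R \<in> carrier_mat n n"
    and nonneg: "\<And>i j. i < n \<Longrightarrow> j < n \<Longrightarrow> 0 \<le> R $$ (i, j)"
    and "0 \<le> c" and super: "\<And>i. i < n \<Longrightarrow> c * w i \<le> (\<Sum>j<n. R $$ (i, j) * w j)"
    and i: "i < n"
  shows "(\<forall>j<n. 0 \<le> (R ^\<^sub>m k) $$ (i, j)) \<and> c ^ k * w i \<le> (\<Sum>j<n. (R ^\<^sub>m k) $$ (i, j) * w j)"
proof (induction k)
  case 0
  then show ?case using R i by (auto simp: if_distrib[of "\<lambda>x. x * _"] cong: if_cong)
next
  case (Suc k)
  let ?E = "R ^\<^sub>m k"
  have E: "?E \<in> carrier_mat n n" using R by simp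
  have entry: "(R ^\<^sub>m Suc k) $$ (i, j) = (\<Sum>l<n. ?E $$ (i, l) * R $$ (l, j))" if "j < n" for j
    using R E i that by (simp add: scalar_prod_def lessThan_atLeast0)
  have "c ^ Suc k * w i \<le> c * (\<Sum>l<n. ?E $$ (i, l) * w l)"
    using Suc \<open>0 \<le> c\<close> by (simp add: mult.assoc mult_left_mono)
  also have "\<dots> = (\<Sum>l<n. ?E $$ (i, l) * (c * w l))" by (simp add: sum_distrib_left algebra_simps)
  also have "\<dots> \<le> (\<Sum>l<n. ?E $$ (i, l) * (\<Sum>j<n. R $$ (l, j) * w j))"
    using Suc super by (intro sum_mono mult_left_mono) auto
  also have "\<dots> = (\<Sum>l<n. \<Sum>j<n. ?E $$ (i, l) * R $$ (l, j) * w j)"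
    by (simp add: sum_distrib_left algebra_simps)
  also have "\<dots> = (\<Sum>j<n. \<Sum>l<n. ?E $$ (i, l) * R $$ (l, j) * w j)"
    by (rule sum.swap)
  also have "\<dots> = (\<Sum>j<n. (R ^\<^sub>m Suc k) $$ (i, j) * w j)"
    using entry by (intro sum.cong) (auto simp: sum_distrib_right)
  finally show ?case using entry Suc nonneg by (auto intro!: sum_nonneg mult_nonneg_nonneg)
qed

text \<open>
  The matching lower bound follows from growth. If the spectral radius
  were below \<open>c\<close>, one could divide the matrix by some \<open>d < c\<close> that is still larger than the spectral
  radius. The powers of the quotient are then bounded by the Jordan normal form, whereas applied to
  \<open>w\<close> they grow at least like \<open>(c / d) ^ k\<close>.
\<close>

lemma spectral_radius_ge_of_superinvariant:
  fixes R :: "real mat" and w :: "nat \<Rightarrow> real"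
  assumes R: "R \<in> carrier_mat n n" and n: "1 \<le> n"
    and nonneg: "\<And>i j. i < n \<Longrightarrow> j < n \<Longrightarrow> 0 \<le> R $$ (i, j)"
    and w: "\<And>i. i < n \<Longrightarrow> 0 < w i"
    and super: "\<And>i. i < n \<Longrightarrow> c * w i \<le> (\<Sum>j<n. R $$ (i, j) * w j)"
  shows "c \<le> spectral_radius (map_mat complex_of_real R)"
proof (rule ccontr)
  let ?C = "map_mat complex_of_real R"
  define s where "s = spectral_radius ?C"
  assume "\<not> ?thesis"
  then have "s < c" by (simp add: s_def)
  have C: "?C \<in> carrier_mat n n" using R by simp
  have s0: "0 \<le> s" using spectral_radius_mem_max(1)[OF C] n by (auto simp: s_def)
  obtain d where d: "s < d" "d < c" using \<open>s < c\<close> dense by blast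
  have d0: "0 < d" using s0 d by simp
  define S where "S = (1 / d) \<cdot>\<^sub>m R"
  let ?D = "map_mat complex_of_real S"
  have S: "S \<in> carrier_mat n n" and D: "?D \<in> carrier_mat n n" using R by (auto simp: S_def)
  have "spectral_radius ?D < 1"
  proof -
    obtain ev where ev: "ev \<in> spectrum ?D" and sr: "spectral_radius ?D = norm ev"
      using spectral_radius_mem_max(1)[OF D] n by auto
    then obtain x where x: "x \<in> carrier_vec n" "x \<noteq> 0\<^sub>v n" and eig: "?D *\<^sub>v x = ev \<cdot>\<^sub>v x"
      using S by (auto simp: spectrum_def eigenvalue_def eigenvector_def)
    have "?C *\<^sub>v x = (of_real d * ev) \<cdot>\<^sub>v x"
    proof (rule eq_vecI)
      fix i assume "i < dim_vec ((of_real d * ev) \<cdot>\<^sub>v x)"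
      then have i: "i < n" using x by simp
      have "(\<Sum>j<n. complex_of_real (R $$ (i, j)) / of_real d * x $ j) = ev * x $ i"
        using arg_cong[OF eig, of "\<lambda>y. y $ i"] i x(1) R S
        by (simp add: scalar_prod_def lessThan_atLeast0 S_def)
      then have "(\<Sum>j<n. complex_of_real (R $$ (i, j)) * x $ j) / of_real d = ev * x $ i"
        by (simp add: sum_divide_distrib)
      then have "(\<Sum>j<n. complex_of_real (R $$ (i, j)) * x $ j) = of_real d * ev * x $ i"
        using d0 by (simp add: field_simps)
      then show "(?C *\<^sub>v x) $ i = ((of_real d * ev) \<cdot>\<^sub>v x) $ i"
        using i x(1) R by (simp add: scalar_prod_def lessThan_atLeast0)
    qed (use R x in auto)
    then have "of_real d * ev \<in> spectrum ?C"
      using R x by (auto simp: spectrum_def eigenvalue_def eigenvector_def)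
    then have "norm (of_real d * ev) \<le> s"
      using spectral_radius_mem_max(2)[OF C] n by (simp add: s_def)
    then have "d * norm ev \<le> s" using d0 by (simp add: norm_mult)
    then have "d * norm ev < d * 1" using d(1) by linarith
    then show ?thesis using d0 sr by (simp only: mult_less_cancel_left_pos)
  qed
  then obtain b where b: "norm_bound (?D ^\<^sub>m k) b" for k
    using spectral_radius_jnf_norm_bound_less_1_upper_triangular[OF D] by blast
  have pow: "?D ^\<^sub>m k = map_mat complex_of_real (S ^\<^sub>m k)" for k
    by (simp add: of_real_hom.mat_hom_pow[OF S])
  have entry: "\<bar>(S ^\<^sub>m k) $$ (0, j)\<bar> \<le> b" if "j < n" for j k
    using b[of k] that n S unfolding pow norm_bound_def by auto
  have grow: "(c / d) ^ k * w 0 \<le> (\<Sum>j<n. (S ^\<^sub>m k) $$ (0, j) * w j)" for k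
  proof -
    have "c / d * w i \<le> (\<Sum>j<n. S $$ (i, j) * w j)" if "i < n" for i
    proof -
      have "(\<Sum>j<n. S $$ (i, j) * w j) = (\<Sum>j<n. R $$ (i, j) * w j) / d"
        using R that by (simp add: S_def sum_divide_distrib)
      then show ?thesis using super[OF that] d0 by (simp add: divide_right_mono)
    qed
    moreover have "0 \<le> S $$ (i, j)" if "i < n" "j < n" for i j
      using R nonneg that d0 by (simp add: S_def)
    ultimately show ?thesis using row_weight_pow_ge[OF S, of "c / d" w 0 k] n d d0 by auto
  qed
  have bound: "(c / d) ^ k * w 0 \<le> b * (\<Sum>j<n. w j)" for k
  proof -
    have "(\<Sum>j<n. (S ^\<^sub>m k) $$ (0, j) * w j) \<le> (\<Sum>j<n. b * w j)"
      using entry w by (intro sum_mono mult_right_mono) (auto simp: abs_le_iff less_imp_le)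
    then show ?thesis using grow[of k] by (simp add: sum_distrib_left)
  qed
  have w0: "0 < w 0" using w n by simp
  obtain k where "b * (\<Sum>j<n. w j) / w 0 < (c / d) ^ k"
    using real_arch_pow[of "c / d"] d d0 by auto
  then show False using bound[of k] w0 by (simp add: field_simps)
qed


section \<open>The eigenvalue as the largest zero\<close>

text \<open>
  The eigenvector is only required to be nonnegative and nonzero, but one positive coordinate forces
  all coordinates of \<open>A \<boxtimes> v\<close>, hence of \<open>v\<close>, to be positive.
\<close>

lemma boxtimes_eigenvalue_iff_max_eigen:
  fixes A :: "real mat"
  assumes n: "1 \<le> n" and A: "A \<in> carrier_mat n n"
    and pos: "\<And>i j. i < n \<Longrightarrow> j < n \<Longrightarrow> 0 < A $$ (i, j)"
  shows "boxtimes_eigenvalue A c \<longleftrightarrow> 0 < c \<and> (\<exists>v. max_eigen n (\<lambda>i j. A $$ (i, j)) c v)"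
proof -
  have fin: "finite ((\<lambda>j. A $$ (i, j) * v j) ` {..<n})" "(\<lambda>j. A $$ (i, j) * v j) ` {..<n} \<noteq> {}"
    for i and v :: "nat \<Rightarrow> real"
    using n by (auto simp: lessThan_empty_iff)
  have row: "boxtimes A v $ i = Max ((\<lambda>j. A $$ (i, j) * v $ j) ` {..<n})"
    if "\<forall>j<n. 0 \<le> v $ j" "i < n" for v :: "real vec" and i
    using that A n pos boxplus_nonneg[of "{0..<n}" "\<lambda>j. A $$ (i, j) * v $ j"]
    by (auto simp: boxtimes_def lessThan_atLeast0 less_imp_le)
  show ?thesis
  proof (intro iffI conjI; (elim conjE exE)?)
    assume "boxtimes_eigenvalue A c"
    then obtain v where c: "0 < c" and v: "v \<in> carrier_vec n" "\<forall>i<n. 0 \<le> v $ i" "v \<noteq> 0\<^sub>v n"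
      and eig: "boxtimes A v = c \<cdot>\<^sub>v v"
      using A by (auto simp: boxtimes_eigenvalue_def)
    show "0 < c" by fact
    have Max_eq: "Max ((\<lambda>j. A $$ (i, j) * v $ j) ` {..<n}) = c * v $ i" if "i < n" for i
      using row[OF v(2) that] eig v(1) that by simp
    have sub: "A $$ (i, j) * v $ j \<le> c * v $ i" if "i < n" "j < n" for i j
      using Max_ge[OF fin(1), of _ i "\<lambda>j. v $ j"] Max_eq that by force
    have tight: "\<exists>j<n. A $$ (i, j) * v $ j = c * v $ i" if "i < n" for i
      using Max_in[OF fin, of i "\<lambda>j. v $ j"] Max_eq[OF that] by force
    obtain l where l: "l < n" "v $ l \<noteq> 0" using v(1,3) by (auto simp: vec_eq_iff)
    have "0 < v $ i" if "i < n" for i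
    proof -
      have "0 < A $$ (i, l) * v $ l" using l v(2) pos[OF that l(1)] by (simp add: order_less_le)
      also have "\<dots> \<le> c * v $ i" by (rule sub[OF that l(1)])
      finally show ?thesis using c by (simp add: zero_less_mult_iff)
    qed
    then have "max_eigen n (\<lambda>i j. A $$ (i, j)) c (\<lambda>i. v $ i)"
      using sub tight by (auto simp: max_eigen_def max_subeigen_def tight_rows_def)
    then show "\<exists>v. max_eigen n (\<lambda>i j. A $$ (i, j)) c v" by blast
  next
    fix v assume c: "0 < c" and "max_eigen n (\<lambda>i j. A $$ (i, j)) c v"
    then have v: "\<forall>i<n. 0 < v i" and sub: "\<And>i j. i < n \<Longrightarrow> j < n \<Longrightarrow> A $$ (i, j) * v j \<le> c * v i"
      and tight: "\<And>i. i < n \<Longrightarrow> \<exists>j<n. A $$ (i, j) * v j = c * v i"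
      by (auto simp: max_eigen_def max_subeigen_def tight_rows_def)
    have Max_eq: "Max ((\<lambda>j. A $$ (i, j) * vec n v $ j) ` {..<n}) = c * v i" if "i < n" for i
    proof (rule Max_eqI[OF fin(1)])
      show "c * v i \<in> (\<lambda>j. A $$ (i, j) * vec n v $ j) ` {..<n}"
        using tight[OF that] by force
    qed (use sub[OF that] in auto)
    have "boxtimes A (vec n v) = c \<cdot>\<^sub>v vec n v"
    proof (rule eq_vecI)
      fix i assume "i < dim_vec (c \<cdot>\<^sub>v vec n v)"
      then have i: "i < n" by simp
      show "boxtimes A (vec n v) $ i = (c \<cdot>\<^sub>v vec n v) $ i"
        using row[of "vec n v" i] v i Max_eq[OF i] by (auto simp: less_imp_le)
    qed (use A in \<open>simp add: boxtimes_def\<close>)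
    moreover have "vec n v \<noteq> 0\<^sub>v n"
      using v n by (auto simp: vec_eq_iff intro!: exI[of _ 0])
    ultimately show "boxtimes_eigenvalue A c"
      using c v A by (auto simp: boxtimes_eigenvalue_def intro!: bexI[of _ "vec n v"] less_imp_le)
  qed
qed

text \<open>
  Along a permutation the factors \<open>v (\<sigma> i)\<close> are those of \<open>v\<close> in another order, so they cancel when
  the inequalities (or equalities) \<open>a i (\<sigma> i) * v (\<sigma> i) \<le> c * v i\<close> are multiplied.
\<close>

lemma prod_permutation_rescale:
  fixes a :: "nat \<Rightarrow> nat \<Rightarrow> real"
  assumes \<sigma>: "\<sigma> permutes h" and v: "\<And>i. i \<in> h \<Longrightarrow> 0 < v i"
  shows "(\<Prod>i\<in>h. a i (\<sigma> i)) * (\<Prod>i\<in>h. v i) = (\<Prod>i\<in>h. a i (\<sigma> i) * v (\<sigma> i))"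
  using prod.permute[OF \<sigma>, of v] by (simp add: prod.distrib o_def)

lemma permutation_weight_le:
  fixes a :: "nat \<Rightarrow> nat \<Rightarrow> real"
  assumes h: "h \<subseteq> {..<n}" and \<sigma>: "\<sigma> permutes h"
    and pos: "\<And>i j. i < n \<Longrightarrow> j < n \<Longrightarrow> 0 < a i j"
    and v: "\<forall>i<n. 0 < v i" "max_subeigen n a c v"
  shows "(\<Prod>i\<in>h. a i (\<sigma> i)) \<le> c ^ card h"
proof -
  have hn: "i < n" "\<sigma> i < n" "0 < v i" if "i \<in> h" for i
    using that h v permutes_in_image[OF \<sigma>, of i] by auto
  have "(\<Prod>i\<in>h. a i (\<sigma> i)) * (\<Prod>i\<in>h. v i) = (\<Prod>i\<in>h. a i (\<sigma> i) * v (\<sigma> i))"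
    by (rule prod_permutation_rescale[OF \<sigma> hn(3)])
  also have "\<dots> \<le> (\<Prod>i\<in>h. c * v i)"
    using hn pos v by (intro prod_mono) (auto simp: max_subeigen_def less_imp_le)
  also have "\<dots> = c ^ card h * (\<Prod>i\<in>h. v i)" by (simp add: prod.distrib)
  finally show ?thesis using hn by (simp add: prod_pos)
qed

text \<open>
  Choosing in every row an arc with equality defines a self-map of the index set; its cycle is a
  permutation whose weight attains the bound \<open>permutation_weight_le\<close>.
\<close>

lemma critical_cycle:
  fixes a :: "nat \<Rightarrow> nat \<Rightarrow> real"
  assumes n: "1 \<le> n" and v: "max_eigen n a c v"
  obtains h \<sigma> where "h \<subseteq> {..<n}" "h \<noteq> {}" "\<sigma> permutes h" "sign \<sigma> = (-1) ^ (card h - 1)"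
    "(\<Prod>i\<in>h. a i (\<sigma> i)) = c ^ card h"
proof -
  have vpos: "\<forall>i<n. 0 < v i" and "\<forall>i<n. \<exists>j<n. a i j * v j = c * v i"
    using v by (auto simp: max_eigen_def tight_rows_def)
  then obtain f where f: "\<And>i. i < n \<Longrightarrow> f i < n" "\<And>i. i < n \<Longrightarrow> a i (f i) * v (f i) = c * v i"
    by metis
  obtain h \<sigma> where h: "h \<subseteq> {..<n}" "h \<noteq> {}" "\<sigma> permutes h" and \<sigma>f: "\<forall>i\<in>h. \<sigma> i = f i"
    and sgn: "sign \<sigma> = (-1) ^ (card h - 1)"
    by (rule cyclic_permutation_of_self_map[OF n f(1)])
  have hn: "i < n" "0 < v i" if "i \<in> h" for i using that h vpos by auto
  have "(\<Prod>i\<in>h. a i (\<sigma> i)) * (\<Prod>i\<in>h. v i) = (\<Prod>i\<in>h. a i (\<sigma> i) * v (\<sigma> i))"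
    by (rule prod_permutation_rescale[OF h(3) hn(2)])
  also have "\<dots> = (\<Prod>i\<in>h. c * v i)"
    using \<sigma>f f(2) hn by (intro prod.cong) auto
  also have "\<dots> = c ^ card h * (\<Prod>i\<in>h. v i)" by (simp add: prod.distrib)
  finally have "(\<Prod>i\<in>h. a i (\<sigma> i)) = c ^ card h"
    using prod_pos[of h v] hn by force
  then show ?thesis using that h sgn by blast
qed

lemma finite_perm_triples: "finite (perm_triples n)"
proof (rule finite_subset)
  show "perm_triples n \<subseteq> {..n} \<times> (SIGMA h : Pow {0..<n}. {\<sigma>. \<sigma> permutes h})"
    by (auto simp: perm_triples_def)
  show "finite ({..n} \<times> (SIGMA h : Pow {0..<n}. {\<sigma>. \<sigma> permutes h}))"
    by (intro finite_cartesian_product finite_SigmaI finite_permutations)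
      (auto intro: finite_subset)
qed

lemma abs_char_monomial:
  assumes A: "A \<in> carrier_mat n n" and pos: "\<And>i j. i < n \<Longrightarrow> j < n \<Longrightarrow> 0 < A $$ (i, j)"
    and t: "(k, h, \<sigma>) \<in> perm_triples n" and "0 \<le> x"
  shows "\<bar>char_monomial A x (k, h, \<sigma>)\<bar> = (\<Prod>i\<in>h. A $$ (i, \<sigma> i)) * x ^ (n - k)"
proof -
  have h: "h \<subseteq> {0..<n}" and \<sigma>: "\<sigma> permutes h" using t by (auto simp: perm_triples_def)
  have "0 < A $$ (i, \<sigma> i)" if "i \<in> h" for i
    using that h permutes_in_image[OF \<sigma>, of i] by (intro pos) auto
  then have "0 \<le> (\<Prod>i\<in>h. A $$ (i, \<sigma> i))" by (intro prod_nonneg) (auto simp: less_imp_le)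
  moreover have "\<bar>real_of_int (sign \<sigma>)\<bar> = 1" by (simp add: sign_def)
  ultimately show ?thesis
    using A \<open>0 \<le> x\<close> by (simp add: char_monomial_def abs_mult power_abs)
qed

lemma char_monomial_empty:
  assumes "A \<in> carrier_mat n n"
  shows "char_monomial A x (0, {}, id) = (-1) ^ n * x ^ n"
  using assms by (simp add: char_monomial_def sign_id)

text \<open>
  The monomials of the empty permutation and of a critical cycle both have the largest modulus
  \<open>c ^ n\<close> and have opposite signs.
\<close>

lemma smile_sum_at_max_eigenvalue:
  assumes n: "1 \<le> n" and A: "A \<in> carrier_mat n n"
    and pos: "\<And>i j. i < n \<Longrightarrow> j < n \<Longrightarrow> 0 < A $$ (i, j)"
    and c: "0 < c" and v: "max_eigen n (\<lambda>i j. A $$ (i, j)) c v"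
  shows "P_minus A c + P_plus A c = 0"
proof -
  obtain h \<sigma> where h: "h \<subseteq> {..<n}" "h \<noteq> {}" "\<sigma> permutes h"
    and sgn: "sign \<sigma> = (-1) ^ (card h - 1)" and weight: "(\<Prod>i\<in>h. A $$ (i, \<sigma> i)) = c ^ card h"
    by (rule critical_cycle[OF n v])
  have fin: "finite h" using h(1) finite_subset by blast
  have card: "card h \<le> n" "1 \<le> card h"
    using card_mono[OF _ h(1)] h(2) fin by (auto simp: Suc_le_eq card_gt_0_iff)
  define k where "k = card h"
  have "(-1::real) ^ (n - k) * (-1) ^ (k - 1) = (-1) ^ (n - 1)"
    using card by (simp flip: power_add add: k_def)
  also have "\<dots> = - ((-1) ^ n)" using n by (cases n) auto
  finally have signs: "(-1::real) ^ (n - k) * (-1) ^ (k - 1) = - ((-1) ^ n)" .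
  have "char_monomial A c (k, h, \<sigma>) = (-1) ^ (n - k) * (-1) ^ (k - 1) * (c ^ k * c ^ (n - k))"
    using A by (simp add: char_monomial_def sgn weight k_def)
  also have "c ^ k * c ^ (n - k) = c ^ n" using card by (simp flip: power_add add: k_def)
  finally have opp: "char_monomial A c (k, h, \<sigma>) = - char_monomial A c (0, {}, id)"
    unfolding signs char_monomial_empty[OF A] by simp
  have "Smile_minus (char_monomial A c) (perm_triples n) + Smile_plus (char_monomial A c) (perm_triples n) = 0"
  proof (rule smile_sum_zero_of_opposite[OF finite_perm_triples _ _ opp])
    show "(0, {}, id) \<in> perm_triples n" by (simp add: perm_triples_def permutes_id)
    show "(k, h, \<sigma>) \<in> perm_triples n" using h card by (auto simp: perm_triples_def k_def)
    fix z assume z: "z \<in> perm_triples n"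
    obtain l g \<tau> where zd: "z = (l, g, \<tau>)" by (cases z)
    have g: "g \<subseteq> {..<n}" "\<tau> permutes g" "l = card g" "l \<le> n"
      using z zd by (auto simp: perm_triples_def)
    have "\<bar>char_monomial A c z\<bar> \<le> c ^ l * c ^ (n - l)"
      using abs_char_monomial[OF A pos, of l g \<tau> c] z zd c
        permutation_weight_le[of g n \<tau> "\<lambda>i j. A $$ (i, j)" v c] g pos v
      by (auto simp: max_eigen_def)
    also have "\<dots> = c ^ n" using g by (simp flip: power_add)
    finally show "\<bar>char_monomial A c z\<bar> \<le> \<bar>char_monomial A c (0, {}, id)\<bar>"
      using c by (simp add: char_monomial_empty[OF A] abs_mult power_abs)
  qed
  then show ?thesis using A by (simp add: P_minus_def P_plus_def)
qed

text \<open>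
  A permutation of \<open>l \<ge> 1\<close> indices contributes at most \<open>c ^ l * x ^ (n - l) < x ^ n\<close>, so the empty
  permutation dominates strictly.
\<close>

lemma smile_sum_above_max_eigenvalue:
  assumes n: "1 \<le> n" and A: "A \<in> carrier_mat n n"
    and pos: "\<And>i j. i < n \<Longrightarrow> j < n \<Longrightarrow> 0 < A $$ (i, j)"
    and c: "0 < c" and v: "max_eigen n (\<lambda>i j. A $$ (i, j)) c v" and x: "c < x"
  shows "P_minus A x + P_plus A x \<noteq> 0"
proof -
  have "Smile_minus (char_monomial A x) (perm_triples n) + Smile_plus (char_monomial A x) (perm_triples n) \<noteq> 0"
  proof (rule smile_sum_nonzero_of_dominant[OF finite_perm_triples, of "(0, {}, id)"])
    show "(0, {}, id) \<in> perm_triples n" by (simp add: perm_triples_def permutes_id)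
    show "char_monomial A x (0, {}, id) \<noteq> 0" using c x by (simp add: char_monomial_empty[OF A])
    fix z assume z: "z \<in> perm_triples n" "z \<noteq> (0, {}, id)"
    obtain l g \<tau> where zd: "z = (l, g, \<tau>)" by (cases z)
    have g: "g \<subseteq> {..<n}" "\<tau> permutes g" "l = card g" "l \<le> n"
      using z zd by (auto simp: perm_triples_def)
    have "finite g" using g(1) finite_subset by blast
    then have "l \<noteq> 0" using z(2) zd g by auto
    have "\<bar>char_monomial A x z\<bar> \<le> c ^ l * x ^ (n - l)"
      using abs_char_monomial[OF A pos, of l g \<tau> x] z zd c x
        permutation_weight_le[of g n \<tau> "\<lambda>i j. A $$ (i, j)" v c] g pos v
      by (auto simp: max_eigen_def)
    also have "\<dots> < x ^ l * x ^ (n - l)"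
      using c x \<open>l \<noteq> 0\<close> by (intro mult_strict_right_mono power_strict_mono) auto
    also have "\<dots> = x ^ n" using g by (simp flip: power_add)
    finally show "\<bar>char_monomial A x z\<bar> < \<bar>char_monomial A x (0, {}, id)\<bar>"
      using c x by (simp add: char_monomial_empty[OF A] abs_mult power_abs)
  qed
  then show ?thesis using A by (simp add: P_minus_def P_plus_def)
qed

text \<open>
  With \<open>r = 2 * p + 1\<close>, the entries of \<open>Phi p A\<close> times the test vector \<open>v i ^ r\<close> are the \<open>r\<close>-th powers
  of \<open>A $$ (i, j) * v j\<close>. In row \<open>i\<close> each of the \<open>n\<close> terms is at most \<open>(c * v i) ^ r\<close>, and one of them
  attains it.
\<close>

lemma rho_bounds:
  assumes n: "1 \<le> n" and A: "A \<in> carrier_mat n n"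
    and pos: "\<And>i j. i < n \<Longrightarrow> j < n \<Longrightarrow> 0 < A $$ (i, j)"
    and c: "0 < c" and v: "max_eigen n (\<lambda>i j. A $$ (i, j)) c v"
  shows "c \<le> rho p A" "rho p A \<le> root (2 * p + 1) (real n) * c"
proof -
  define r where "r = 2 * p + 1"
  have r: "0 < r" by (simp add: r_def)
  define s where "s = spectral_radius (map_mat complex_of_real (Phi p A))"
  define w where "w i = v i ^ r" for i
  have vpos: "0 < v i" if "i < n" for i using v that by (simp add: max_eigen_def)
  have sub: "A $$ (i, j) * v j \<le> c * v i" if "i < n" "j < n" for i j
    using v that by (simp add: max_eigen_def max_subeigen_def)
  have tight: "\<exists>j<n. A $$ (i, j) * v j = c * v i" if "i < n" for i
    using v that by (auto simp: max_eigen_def tight_rows_def)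
  have Phi: "Phi p A \<in> carrier_mat n n" using A by (simp add: Phi_def)
  have entry: "Phi p A $$ (i, j) * w j = (A $$ (i, j) * v j) ^ r" if "i < n" "j < n" for i j
    using A that by (simp add: Phi_def w_def r_def power_mult_distrib)
  have nonneg: "0 \<le> Phi p A $$ (i, j)" if "i < n" "j < n" for i j
    using A that pos[OF that] by (simp add: Phi_def)
  have wpos: "0 < w i" if "i < n" for i using vpos[OF that] by (simp add: w_def)
  have "s \<le> real n * c ^ r"
    unfolding s_def
  proof (rule spectral_radius_le_of_subinvariant[OF Phi n nonneg wpos])
    fix i assume i: "i < n"
    have "(\<Sum>j<n. Phi p A $$ (i, j) * w j) \<le> (\<Sum>j<n. (c * v i) ^ r)"
      using entry[OF i] sub[OF i] pos[OF i] vpos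
      by (intro sum_mono) (auto intro!: power_mono mult_nonneg_nonneg simp: less_imp_le)
    then show "(\<Sum>j<n. Phi p A $$ (i, j) * w j) \<le> real n * c ^ r * w i"
      by (simp add: w_def power_mult_distrib mult.assoc)
  qed
  then have "root r s \<le> root r (real n * c ^ r)" using r by simp
  then show "rho p A \<le> root (2 * p + 1) (real n) * c"
    using r c unfolding rho_def s_def[symmetric] r_def[symmetric]
    by (simp add: real_root_mult real_root_power_cancel)
  have "c ^ r \<le> s"
    unfolding s_def
  proof (rule spectral_radius_ge_of_superinvariant[OF Phi n nonneg wpos])
    fix i assume i: "i < n"
    obtain j where j: "j < n" "A $$ (i, j) * v j = c * v i" using tight[OF i] by blast
    have "c ^ r * w i = Phi p A $$ (i, j) * w j"
      using entry[OF i j(1)] j(2) by (simp add: w_def power_mult_distrib)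
    also have "\<dots> \<le> (\<Sum>j<n. Phi p A $$ (i, j) * w j)"
      using j nonneg[OF i] wpos by (intro member_le_sum) (auto intro!: mult_nonneg_nonneg simp: less_imp_le)
    finally show "c ^ r * w i \<le> (\<Sum>j<n. Phi p A $$ (i, j) * w j)" .
  qed
  then have "root r (c ^ r) \<le> root r s" using r by simp
  then show "c \<le> rho p A"
    using r c unfolding rho_def s_def[symmetric] r_def[symmetric]
    by (simp add: real_root_power_cancel)
qed

lemma rho_tendsto_max_eigenvalue:
  assumes n: "1 \<le> n" and A: "A \<in> carrier_mat n n"
    and pos: "\<And>i j. i < n \<Longrightarrow> j < n \<Longrightarrow> 0 < A $$ (i, j)"
    and c: "0 < c" and v: "max_eigen n (\<lambda>i j. A $$ (i, j)) c v"
  shows "(\<lambda>p. rho p A) \<longlonglongrightarrow> c"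
proof (rule tendsto_sandwich[where f = "\<lambda>_. c" and h = "\<lambda>p. root (2 * p + 1) (real n) * c"])
  have "(\<lambda>p. root (2 * p + 1) (real n)) \<longlonglongrightarrow> 1"
    using LIMSEQ_subseq_LIMSEQ[OF LIMSEQ_root_const, of "real n" "\<lambda>p. 2 * p + 1"] n
    by (simp add: strict_mono_def o_def)
  then show "(\<lambda>p. root (2 * p + 1) (real n) * c) \<longlonglongrightarrow> c"
    using tendsto_mult_right[of _ 1 sequentially c] by simp
qed (use rho_bounds[OF assms] in auto)

theorem proposition6p0p4:
  fixes n :: nat and A :: "real mat"
  assumes "n \<ge> 1"
    and "A \<in> carrier_mat n n"
    and "\<And>i j. i < n \<Longrightarrow> j < n \<Longrightarrow> A $$ (i, j) > 0"
  shows "(\<forall>\<mu>>0. boxtimes_eigenvalue A \<mu> \<longrightarrow> P_minus A \<mu> + P_plus A \<mu> = 0) \<and>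
    (\<forall>\<mu>. \<mu> \<in> {\<nu>. P_minus A \<nu> + P_plus A \<nu> = 0} \<and>
         (\<forall>\<nu> \<in> {\<nu>. P_minus A \<nu> + P_plus A \<nu> = 0}. \<nu> \<le> \<mu>) \<longrightarrow>
       boxtimes_eigenvalue A \<mu> \<and>
       (\<exists>p :: nat \<Rightarrow> nat. strict_mono p \<and> (\<lambda>q. rho (p q) A) \<longlonglongrightarrow> \<mu>))"
proof (intro conjI allI impI)
  note eigenvalue_iff = boxtimes_eigenvalue_iff_max_eigen[OF assms]
  fix \<mu> :: real
  {
    assume "boxtimes_eigenvalue A \<mu>"
    then show "P_minus A \<mu> + P_plus A \<mu> = 0"
      using smile_sum_at_max_eigenvalue[OF assms] eigenvalue_iff by blast
  }
  assume max: "\<mu> \<in> {\<nu>. P_minus A \<nu> + P_plus A \<nu> = 0} \<and>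
         (\<forall>\<nu> \<in> {\<nu>. P_minus A \<nu> + P_plus A \<nu> = 0}. \<nu> \<le> \<mu>)"
  obtain c v where c: "0 < c" and v: "max_eigen n (\<lambda>i j. A $$ (i, j)) c v"
    by (rule max_eigen_exists[of n "\<lambda>i j. A $$ (i, j)", OF assms(1,3)])
  have "c \<le> \<mu>" using max smile_sum_at_max_eigenvalue[OF assms c v] by simp
  moreover have "\<not> c < \<mu>" using max smile_sum_above_max_eigenvalue[OF assms c v] by blast
  ultimately have \<mu>: "\<mu> = c" by simp
  show "boxtimes_eigenvalue A \<mu>" using eigenvalue_iff c v \<mu> by blast
  \<comment> \<open>The whole sequence converges, so the identity serves as the increasing sequence.\<close>
  show "\<exists>p :: nat \<Rightarrow> nat. strict_mono p \<and> (\<lambda>q. rho (p q) A) \<longlonglongrightarrow> \<mu>"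
    using rho_tendsto_max_eigenvalue[OF assms c v] \<mu>
    by (intro exI[of _ "\<lambda>q. q"]) (simp add: strict_mono_def)
qed

end
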